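(* Let $\Sigma$ be a finite alphabet, $\mathbb{D}$ a value domain, and $\varPhi : \Sigma^\omega \to \mathbb{D}$ a property. If $\varPhi$ is safe (respectively, co-safe), then it is continuous with respect to the dual Scott topology (respectively, the Scott topology) on $\mathbb{D}$, where $\Sigma^\omega$ carries the Cantor topology.
   Context: $\Sigma^*$ and $\Sigma^\omega$ are the sets of finite and infinite words over the finite nonempty alphabet $\Sigma$; $u \prec w$ means that the finite word $u$ is a strict prefix of $w$ (the empty word is allowed). A value domain $\mathbb{D}$ is a complete lattice with $\bot \neq \top$. A property is a total function $\varPhi : \Sigma^\omega \to \mathbb{D}$. $\varPhi$ is safe when for every $w \in \Sigma^\omega$ and $v \in \mathbb{D}$ with $\varPhi(w) \not\geq v$, there is $u \prec w$ such that $\sup_{w' \in \Sigma^\omega} \varPhi(uw') \not\geq v$. $\varPhi$ is co-safe when for every $w \in \Sigma^\omega$ and $v \in \mathbb{D}$ with $\varPhi(w) \not\leq v$, there is $u \prec w$ such that $\inf_{w' \in \Sigma^\omega} \varPhi(uw') \not\leq v$. In the Cantor topology, a set $P \subseteq \Sigma^\omega$ is open iff for every $w \in P$ there is $u \prec w$ with $u\Sigma^\omega \subseteq P$. A set $S \subseteq \mathbb{D}$ is Scott open iff (i) $S$ is upward closed, and (ii) for every upward-directed set $V \subseteq \mathbb{D}$, $\sup V \in S$ implies $V \cap S \neq \emptyset$. A set $S \subseteq \mathbb{D}$ is dual Scott open iff (i) $S$ is downward closed, and (ii) for every downward-directed set $V \subseteq \mathbb{D}$, $\inf V \in S$ implies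 $V \cap S \neq \emptyset$. (Directed sets are taken nonempty, as is standard.) The (dual) Scott topology is the topology whose open sets are the (dual) Scott open sets. *)

theory Defs
  imports "HOL-Analysis.Abstract_Topology" "HOL-Library.Stream"
begin

text \<open>The alphabet is a type, so it is automatically nonempty; infinite words are streams.\<close>

definition word_prefix :: "'a list \<Rightarrow> 'a stream \<Rightarrow> bool" (infix \<open>\<prec>\<close> 50) where
  "u \<prec> w \<longleftrightarrow> (\<exists>w'. w = u @- w')"

definition cylinder :: "'a list \<Rightarrow> 'a stream set" where
  "cylinder u = {u @- w' | w'. True}"

definition cantor_open :: "'a stream set \<Rightarrow> bool" where
  "cantor_open P \<longleftrightarrow> (\<forall>w\<in>P. \<exists>u. u \<prec> w \<and> cylinder u \<subseteq> P)"

definition cantor_topology :: "'a stream topology" where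
  "cantor_topology = topology cantor_open"

lemma word_prefix_iff: "u \<prec> w \<longleftrightarrow> stake (length u) w = u"
proof
  assume "u \<prec> w"
  then show "stake (length u) w = u" by (auto simp: word_prefix_def stake_shift)
next
  assume "stake (length u) w = u"
  then have "w = u @- sdrop (length u) w" using stake_sdrop[of "length u" w] by simp
  then show "u \<prec> w" unfolding word_prefix_def by blast
qed

lemma mem_cylinder_iff: "w \<in> cylinder u \<longleftrightarrow> u \<prec> w"
  by (auto simp: cylinder_def word_prefix_def)

lemma istopology_cantor_open: "istopology cantor_open"
  unfolding istopology_def
proof (intro conjI allI impI)
  fix S T :: "'a stream set"
  assume S: "cantor_open S" and T: "cantor_open T"
  show "cantor_open (S \<inter> T)"
    unfolding cantor_open_def
  proof
    fix w assume "w \<in> S \<inter> T"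
    then obtain u v where u: "u \<prec> w" "cylinder u \<subseteq> S" and v: "v \<prec> w" "cylinder v \<subseteq> T"
      using S T unfolding cantor_open_def by blast
    define n where "n = max (length u) (length v)"
    have pre: "x \<prec> w'" if "stake n w' = stake n w" "x \<prec> w" "length x \<le> n" for x w'
    proof -
      have "stake (length x) w' = take (length x) (stake n w')"
        using that(3) by (simp add: take_stake min_def)
      also have "\<dots> = stake (length x) w"
        using that(1,3) by (simp add: take_stake min_def)
      finally show ?thesis using that(2) by (simp add: word_prefix_iff)
    qed
    have "cylinder (stake n w) \<subseteq> S \<inter> T"
    proof
      fix w' assume "w' \<in> cylinder (stake n w)"
      then have eq: "stake n w' = stake n w"
        by (simp add: mem_cylinder_iff word_prefix_iff)
      have "u \<prec> w'" "v \<prec> w'"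
        using pre[OF eq u(1)] pre[OF eq v(1)] by (simp_all add: n_def)
      then show "w' \<in> S \<inter> T"
        using u(2) v(2) by (auto simp: mem_cylinder_iff)
    qed
    moreover have "stake n w \<prec> w" by (simp add: word_prefix_iff)
    ultimately show "\<exists>u. u \<prec> w \<and> cylinder u \<subseteq> S \<inter> T" by blast
  qed
next
  fix K :: "'a stream set set"
  assume "\<forall>S\<in>K. cantor_open S"
  then show "cantor_open (\<Union>K)"
    unfolding cantor_open_def by fast
qed

lemma openin_cantor_topology [simp]: "openin cantor_topology P \<longleftrightarrow> cantor_open P"
  by (simp add: cantor_topology_def istopology_cantor_open)

lemma topspace_cantor_topology [simp]: "topspace cantor_topology = UNIV"
proof -
  have "openin cantor_topology UNIV"
    unfolding openin_cantor_topology cantor_open_def word_prefix_def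
    by (metis shift.simps(1) subset_UNIV)
  then show ?thesis using openin_subset by blast
qed

definition up_directed :: "'d::order set \<Rightarrow> bool" where
  "up_directed V \<longleftrightarrow> V \<noteq> {} \<and> (\<forall>x\<in>V. \<forall>y\<in>V. \<exists>z\<in>V. x \<le> z \<and> y \<le> z)"

definition down_directed :: "'d::order set \<Rightarrow> bool" where
  "down_directed V \<longleftrightarrow> V \<noteq> {} \<and> (\<forall>x\<in>V. \<forall>y\<in>V. \<exists>z\<in>V. z \<le> x \<and> z \<le> y)"

definition scott_open :: "'d::complete_lattice set \<Rightarrow> bool" where
  "scott_open S \<longleftrightarrow>
     (\<forall>x\<in>S. \<forall>y. x \<le> y \<longrightarrow> y \<in> S) \<and>
     (\<forall>V. up_directed V \<longrightarrow> Sup V \<in> S \<longrightarrow> V \<inter> S \<noteq> {})"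

definition dual_scott_open :: "'d::complete_lattice set \<Rightarrow> bool" where
  "dual_scott_open S \<longleftrightarrow>
     (\<forall>x\<in>S. \<forall>y. y \<le> x \<longrightarrow> y \<in> S) \<and>
     (\<forall>V. down_directed V \<longrightarrow> Inf V \<in> S \<longrightarrow> V \<inter> S \<noteq> {})"

definition scott_topology :: "'d::complete_lattice topology" where
  "scott_topology = topology scott_open"

definition dual_scott_topology :: "'d::complete_lattice topology" where
  "dual_scott_topology = topology dual_scott_open"

lemma istopology_scott_open: "istopology (scott_open :: 'd::complete_lattice set \<Rightarrow> bool)"
  unfolding istopology_def
proof (intro conjI allI impI)
  fix S T :: "'d set"
  assume S: "scott_open S" and T: "scott_open T"
  have up: "y \<in> S \<inter> T" if "x \<in> S \<inter> T" "x \<le> y" for x y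
    using that S T unfolding scott_open_def by (meson IntD1 IntD2 IntI)
  have acc: "V \<inter> (S \<inter> T) \<noteq> {}" if V: "up_directed V" and sup: "Sup V \<in> S \<inter> T" for V
  proof -
    have "V \<inter> S \<noteq> {}" "V \<inter> T \<noteq> {}"
      using S T V sup by (simp_all add: scott_open_def)
    then obtain x y where xy: "x \<in> V" "x \<in> S" "y \<in> V" "y \<in> T" by auto
    then obtain z where z: "z \<in> V" "x \<le> z" "y \<le> z"
      using V unfolding up_directed_def by meson
    have "z \<in> S" using S xy(2) z(2) unfolding scott_open_def by meson
    moreover have "z \<in> T" using T xy(4) z(3) unfolding scott_open_def by meson
    ultimately show ?thesis using z(1) by auto
  qed
  show "scott_open (S \<inter> T)"
    unfolding scott_open_def using up acc by (intro conjI ballI allI impI)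
next
  fix K :: "'d set set"
  assume K: "\<forall>S\<in>K. scott_open S"
  have up: "y \<in> \<Union>K" if "x \<in> \<Union>K" "x \<le> y" for x y
    using that K unfolding scott_open_def by (meson Union_iff)
  have acc: "V \<inter> \<Union>K \<noteq> {}" if V: "up_directed V" and mem: "Sup V \<in> \<Union>K" for V
  proof -
    obtain S where S: "S \<in> K" "Sup V \<in> S" using mem by auto
    then have "V \<inter> S \<noteq> {}" using K V by (simp add: scott_open_def)
    then show ?thesis using S(1) by auto
  qed
  show "scott_open (\<Union>K)"
    unfolding scott_open_def using up acc by (intro conjI ballI allI impI)
qed

lemma istopology_dual_scott_open:
  "istopology (dual_scott_open :: 'd::complete_lattice set \<Rightarrow> bool)"
  unfolding istopology_def
proof (intro conjI allI impI)
  fix S T :: "'d set"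
  assume S: "dual_scott_open S" and T: "dual_scott_open T"
  have up: "y \<in> S \<inter> T" if "x \<in> S \<inter> T" "y \<le> x" for x y
    using that S T unfolding dual_scott_open_def by (meson IntD1 IntD2 IntI)
  have acc: "V \<inter> (S \<inter> T) \<noteq> {}" if V: "down_directed V" and inf: "Inf V \<in> S \<inter> T" for V
  proof -
    have "V \<inter> S \<noteq> {}" "V \<inter> T \<noteq> {}"
      using S T V inf by (simp_all add: dual_scott_open_def)
    then obtain x y where xy: "x \<in> V" "x \<in> S" "y \<in> V" "y \<in> T" by auto
    then obtain z where z: "z \<in> V" "z \<le> x" "z \<le> y"
      using V unfolding down_directed_def by meson
    have "z \<in> S" using S xy(2) z(2) unfolding dual_scott_open_def by meson
    moreover have "z \<in> T" using T xy(4) z(3) unfolding dual_scott_open_def by meson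
    ultimately show ?thesis using z(1) by auto
  qed
  show "dual_scott_open (S \<inter> T)"
    unfolding dual_scott_open_def using up acc by (intro conjI ballI allI impI)
next
  fix K :: "'d set set"
  assume K: "\<forall>S\<in>K. dual_scott_open S"
  have up: "y \<in> \<Union>K" if "x \<in> \<Union>K" "y \<le> x" for x y
    using that K unfolding dual_scott_open_def by (meson Union_iff)
  have acc: "V \<inter> \<Union>K \<noteq> {}" if V: "down_directed V" and mem: "Inf V \<in> \<Union>K" for V
  proof -
    obtain S where S: "S \<in> K" "Inf V \<in> S" using mem by auto
    then have "V \<inter> S \<noteq> {}" using K V by (simp add: dual_scott_open_def)
    then show ?thesis using S(1) by auto
  qed
  show "dual_scott_open (\<Union>K)"
    unfolding dual_scott_open_def using up acc by (intro conjI ballI allI impI)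
qed

lemma openin_scott_topology [simp]: "openin scott_topology S \<longleftrightarrow> scott_open S"
  by (simp add: scott_topology_def istopology_scott_open)

lemma openin_dual_scott_topology [simp]: "openin dual_scott_topology S \<longleftrightarrow> dual_scott_open S"
  by (simp add: dual_scott_topology_def istopology_dual_scott_open)

lemma topspace_scott_topology [simp]: "topspace scott_topology = UNIV"
proof -
  have "openin scott_topology UNIV"
    by (simp add: scott_open_def up_directed_def)
  then show ?thesis using openin_subset by blast
qed

lemma topspace_dual_scott_topology [simp]: "topspace dual_scott_topology = UNIV"
proof -
  have "openin dual_scott_topology UNIV"
    by (simp add: dual_scott_open_def down_directed_def)
  then show ?thesis using openin_subset by blast
qed

definition safe :: "('a stream \<Rightarrow> 'd::complete_lattice) \<Rightarrow> bool" where
  "safe \<Phi> \<longleftrightarrow>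
     (\<forall>w v. \<not> \<Phi> w \<ge> v \<longrightarrow> (\<exists>u. u \<prec> w \<and> \<not> (SUP w'. \<Phi> (u @- w')) \<ge> v))"

definition co_safe :: "('a stream \<Rightarrow> 'd::complete_lattice) \<Rightarrow> bool" where
  "co_safe \<Phi> \<longleftrightarrow>
     (\<forall>w v. \<not> \<Phi> w \<le> v \<longrightarrow> (\<exists>u. u \<prec> w \<and> \<not> (INF w'. \<Phi> (u @- w')) \<le> v))"

end

theory Submission
  imports Defs
begin

text \<open>Along the finite prefixes of a word \<open>w\<close>, the suprema of a property over the extensions of the
  prefix form a decreasing chain, and safety says exactly that the infimum of this chain lies below
  the value at \<open>w\<close>. A dual Scott open set containing that value therefore contains one of the
  suprema, hence, being downward closed, all values on the cylinder of that prefix. Co-safety is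
  dual.\<close>

text \<open>An extension of the longer prefix is also an extension of the shorter one: the letters
  between positions \<open>m\<close> and \<open>n\<close> move into the tail. Both monotonicity
  lemmas rest on this inclusion of cylinders.\<close>

lemma stake_shift_eq:
  assumes "m \<le> n"
  shows "stake n w @- x = stake m w @- (stake (n - m) (sdrop m w) @- x)"
  by (metis assms le_add_diff_inverse shift_append stake_add)

lemma antimono_SUP_stake:
  fixes \<Phi> :: "'a stream \<Rightarrow> 'd::complete_lattice"
  shows "antimono (\<lambda>n. SUP x. \<Phi> (stake n w @- x))"
proof (rule antimonoI)
  fix m n :: nat assume "m \<le> n"
  show "(SUP x. \<Phi> (stake n w @- x)) \<le> (SUP x. \<Phi> (stake m w @- x))"
    \<comment> \<open>After the rewriting, every term of the left supremum is literally a term of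
      the right one.\<close>
    unfolding stake_shift_eq[OF \<open>m \<le> n\<close>] by (rule SUP_least) (rule SUP_upper, rule UNIV_I)
qed

lemma mono_INF_stake:
  fixes \<Phi> :: "'a stream \<Rightarrow> 'd::complete_lattice"
  shows "mono (\<lambda>n. INF x. \<Phi> (stake n w @- x))"
proof (rule monoI)
  fix m n :: nat assume "m \<le> n"
  show "(INF x. \<Phi> (stake m w @- x)) \<le> (INF x. \<Phi> (stake n w @- x))"
    unfolding stake_shift_eq[OF \<open>m \<le> n\<close>] by (rule INF_greatest) (rule INF_lower, rule UNIV_I)
qed

text \<open>A common lower bound of \<open>f i\<close> and \<open>f j\<close> is
  \<open>f (max i j)\<close>.\<close>

lemma down_directed_range:
  fixes f :: "nat \<Rightarrow> 'd::order"
  assumes "antimono f"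
  shows "down_directed (range f)"
  unfolding down_directed_def using antimonoD[OF assms]
  by simp (metis max.cobounded1 max.cobounded2)

lemma up_directed_range:
  fixes f :: "nat \<Rightarrow> 'd::order"
  assumes "mono f"
  shows "up_directed (range f)"
  unfolding up_directed_def using monoD[OF assms]
  by simp (metis max.cobounded1 max.cobounded2)

lemma safe_INF_SUP_le:
  assumes "safe \<Phi>"
  shows "(INF n. SUP x. \<Phi> (stake n w @- x)) \<le> \<Phi> w" (is "?v \<le> _")
proof (rule ccontr)
  assume "\<not> ?v \<le> \<Phi> w"
  \<comment> \<open>Safety is applied with the infimum of the chain itself as threshold. The prefix
    \<open>u\<close> it yields is \<open>stake (length u) w\<close>, so its supremum belongs to the
    chain and cannot fail to be above \<open>?v\<close>.\<close>
  then obtain u where "u \<prec> w" and *: "\<not> ?v \<le> (SUP x. \<Phi> (u @- x))"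
    using assms unfolding safe_def by blast
  then have "stake (length u) w = u"
    by (simp add: word_prefix_iff)
  then show False
    using * INF_lower[OF UNIV_I, of "\<lambda>n. SUP x. \<Phi> (stake n w @- x)" "length u"] by simp
qed

lemma co_safe_le_SUP_INF:
  assumes "co_safe \<Phi>"
  shows "\<Phi> w \<le> (SUP n. INF x. \<Phi> (stake n w @- x))" (is "_ \<le> ?v")
proof (rule ccontr)
  assume "\<not> \<Phi> w \<le> ?v"
  \<comment> \<open>Here the threshold is the supremum of the increasing chain, of which the infimum
    at \<open>u\<close> is a member.\<close>
  then obtain u where "u \<prec> w" and *: "\<not> (INF x. \<Phi> (u @- x)) \<le> ?v"
    using assms unfolding co_safe_def by blast
  then have "stake (length u) w = u"
    by (simp add: word_prefix_iff)
  then show False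
    using * SUP_upper[OF UNIV_I, of "\<lambda>n. INF x. \<Phi> (stake n w @- x)" "length u"] by simp
qed

text \<open>The prefixes of \<open>w\<close> are exactly the words \<open>stake n w\<close>, so a
  length can serve as the witness for openness.\<close>

lemma cantor_openI:
  assumes "\<And>w. w \<in> P \<Longrightarrow> \<exists>n. \<forall>x. stake n w @- x \<in> P"
  shows "cantor_open P"
  unfolding cantor_open_def
proof
  fix w assume "w \<in> P"
  then obtain n where "\<forall>x. stake n w @- x \<in> P"
    using assms by blast
  then have "stake n w \<prec> w" "cylinder (stake n w) \<subseteq> P"
    by (auto simp: word_prefix_iff cylinder_def)
  then show "\<exists>u. u \<prec> w \<and> cylinder u \<subseteq> P"
    by blast
qed

lemma safe_continuous_map:
  assumes "safe \<Phi>"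
  shows "continuous_map cantor_topology dual_scott_topology \<Phi>"
proof -
  have "cantor_open {w. \<Phi> w \<in> S}" if S: "dual_scott_open S" for S
  proof (rule cantor_openI)
    fix w assume w: "w \<in> {w. \<Phi> w \<in> S}"
    have down: "y \<in> S" if "x \<in> S" "y \<le> x" for x y
      using S that unfolding dual_scott_open_def by blast
    let ?f = "\<lambda>n. SUP x. \<Phi> (stake n w @- x)"
    have "Inf (range ?f) \<in> S"
      using down safe_INF_SUP_le[OF assms] w by blast
    then have "range ?f \<inter> S \<noteq> {}"
      using S down_directed_range[OF antimono_SUP_stake] unfolding dual_scott_open_def by blast
    then obtain n where "?f n \<in> S" by blast
    \<comment> \<open>Each such value is a term of the supremum \<open>?f n\<close>, hence below
      it.\<close>
    then have "\<Phi> (stake n w @- x) \<in> S" for x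
      by (rule down) (rule SUP_upper, rule UNIV_I)
    then show "\<exists>n. \<forall>x. stake n w @- x \<in> {w. \<Phi> w \<in> S}" by blast
  qed
  then show ?thesis by (simp add: continuous_map_def)
qed

lemma co_safe_continuous_map:
  assumes "co_safe \<Phi>"
  shows "continuous_map cantor_topology scott_topology \<Phi>"
proof -
  have "cantor_open {w. \<Phi> w \<in> S}" if S: "scott_open S" for S
  proof (rule cantor_openI)
    fix w assume w: "w \<in> {w. \<Phi> w \<in> S}"
    have up: "y \<in> S" if "x \<in> S" "x \<le> y" for x y
      using S that unfolding scott_open_def by blast
    let ?f = "\<lambda>n. INF x. \<Phi> (stake n w @- x)"
    have "Sup (range ?f) \<in> S"
      using up co_safe_le_SUP_INF[OF assms] w by blast
    then have "range ?f \<inter> S \<noteq> {}"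
      using S up_directed_range[OF mono_INF_stake] unfolding scott_open_def by blast
    then obtain n where "?f n \<in> S" by blast
    then have "\<Phi> (stake n w @- x) \<in> S" for x
      by (rule up) (rule INF_lower, rule UNIV_I)
    then show "\<exists>n. \<forall>x. stake n w @- x \<in> {w. \<Phi> w \<in> S}" by blast
  qed
  \<comment> \<open>Both topologies have the whole type as carrier, so only openness of preimages
    remains.\<close>
  then show ?thesis by (simp add: continuous_map_def)
qed

theorem theorem3p18:
  fixes \<Phi> :: "'a::finite stream \<Rightarrow> 'd::complete_lattice"
  assumes "(bot :: 'd) \<noteq> top"
  shows "(safe \<Phi> \<longrightarrow> continuous_map cantor_topology dual_scott_topology \<Phi>) \<and>
         (co_safe \<Phi> \<longrightarrow> continuous_map cantor_topology scott_topology \<Phi>)"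
  using safe_continuous_map co_safe_continuous_map by blast

end
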